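(* Let $d=1$, $T=2$, $z_0=0$, $\mathcal{R}(v)=|v|$, $\mathcal{E}(z)=\tfrac12 z^2-z$ and $\ell\equiv0$ on $[0,2]$. Let $S=\tfrac52$ and $$\hat z(s)=\begin{cases}0,&s\in[0,1],\\ s-1,&s\in(1,\tfrac32),\\ \tfrac12,&s\in[\tfrac32,\tfrac52],\end{cases}\quad \hat t(s)=\begin{cases}s,&s\in[0,1],\\ 1,&s\in(1,\tfrac32),\\ s-\tfrac12,&s\in[\tfrac32,\tfrac52],\end{cases}\quad \hat\ell(s)=\begin{cases}0,&s\in[0,1],\\ s-1,&s\in(1,\tfrac32),\\ 0,&s\in[\tfrac32,\tfrac52].\end{cases}$$ Then $(S,\hat t,\hat z,\hat\ell)$ is a relaxed solution associated with $\ell\equiv0$, but no element $\bar z\in\mathfrak P(\hat t,\hat z)$ is a local solution associated with $\ell\equiv0$.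
   Context: $BV([0,T])$ is the set of functions $f:[0,T]\to\mathbb{R}$ (defined everywhere) with finite pointwise total variation. $\partial\mathcal R(0)$ is the convex subdifferential of $\mathcal R$ at $0$ (here $[-1,1]$), $\operatorname{dist}(w,\partial\mathcal R(0))$ the distance to it. For a load $\hat\ell$ on $[0,S]$ put $\hat{\mathcal I}(s,z)=\mathcal E(z)-\hat\ell(s)z$; for a load $\ell$ on $[0,T]$ put $\mathcal I(t,z)=\mathcal E(z)-\ell(t)z$. $W^{1,\infty}$ functions are identified with their continuous representatives. Relaxed solution: given $\ell\in BV([0,T])$, a tuple $(S,\hat t,\hat z,\hat\ell)\in(0,\infty)\times W^{1,\infty}(0,S)\times W^{1,\infty}(0,S)\times BV([0,S])$ is a relaxed (normalized, $\mathfrak p$-parametrized BV) solution associated with $\ell$ if: (1) $\hat t(0)=0$, $\hat t(S)=T$, $\hat z(0)=z_0$; (2) for almost all $s\in(0,S)$: $\hat t'(s)\ge0$, $\hat t'(s)\operatorname{dist}(-D_z\hat{\mathcal I}(s,\hat z(s)),\partial\mathcal R(0))=0$, and $\hat t'(s)+\mathcal R(\hat z'(s))+|\hat z'(s)|\operatorname{dist}(-D_z\hat{\mathcal I}(s,\hat z(s)),\partial\mathcal R(0))=1$; (3) for all $s_1,s_2\in[0,S]$: $\mathcal E(\hat z(s_2))+\int_{s_1}^{s_2}\mathcal R(\hat z'(r))+|\hat z'(r)|\operatorname{dist}(-D_z\hat{\mathcal I}(r,\hat z(r)),\partial\mathcal R(0))\,dr=\mathcal E(\hat z(s_1))+\int_{s_1}^{s_2}\hat\ell(r)\hat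 z'(r)\,dr$; (4) $\hat\ell(s)=\ell(\hat t(s))$ for almost all $s\in M$, where $M=\{s\in(0,S):\hat t(s_1)<\hat t(s_2)\text{ for all }s_1,s_2\in[0,S]\text{ with }s_1<s<s_2\}$. Projections: $\mathfrak P(\hat t,\hat z)=\{z:[0,T]\to\mathbb R:\ \forall t\in[0,T]\ \exists s\in[0,S]\text{ with }(t,z(t))=(\hat t(s),\hat z(s))\}$. Local solution: $z\in BV([0,T])$ is a local solution associated with $\ell$ if $0\in\partial\mathcal R(0)+D_z\mathcal I(t,z(t))$ for almost all $t\in[0,T]$ and, for all $0\le t_1\le t_2\le T$, $$\mathcal I(t_2,z(t_2))+\mathrm{Diss}_{\mathcal R}(z;[t_1,t_2])\le\mathcal I(t_1,z(t_1))-\int_{t_1}^{t_2}z(r)\,d\ell(r),$$ where $\mathrm{Diss}_{\mathcal R}(z;[t_1,t_2])=\sup\{\sum_{i=1}^n\mathcal R(z(\xi_i)-z(\xi_{i-1})): t_1=\xi_0<\dots<\xi_n=t_2,\ n\in\mathbb N\}$ and the integral is a Kurzweil (Kurzweil–Stieltjes) integral (which is zero for $\ell\equiv 0$). *)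

theory Defs
  imports "HOL-Analysis.Analysis"
begin

text \<open>
  A function on an interval such as \<open>[0,T]\<close> is represented by a total function on the reals; all
  notions below depend only on the values on that interval.
\<close>

subsection \<open>Dissipation and bounded variation\<close>

text \<open>
  The number \<open>n\<close> of subintervals may be 0, which happens exactly if \<open>a = b\<close>.  The supremum is taken
  in the extended reals, so that it is meaningful without a boundedness assumption.
\<close>

definition Diss :: "(real \<Rightarrow> real) \<Rightarrow> (real \<Rightarrow> real) \<Rightarrow> real \<Rightarrow> real \<Rightarrow> ereal" where
  "Diss R f a b =
     Sup {ereal (\<Sum>i=1..n. R (f (\<xi> i) - f (\<xi> (i - 1)))) | (n::nat) (\<xi>::nat \<Rightarrow> real).
            \<xi> 0 = a \<and> \<xi> n = b \<and> (\<forall>i\<in>{1..n}. \<xi> (i - 1) < \<xi> i)}"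

definition BV :: "real \<Rightarrow> real \<Rightarrow> (real \<Rightarrow> real) \<Rightarrow> bool" where
  "BV a b f \<longleftrightarrow> Diss abs f a b < \<infinity>"

subsection \<open>The space \<open>W\<^sup>1\<^sup>,\<^sup>\<infinity>(0,S)\<close>\<close>

definition Linf :: "real \<Rightarrow> (real \<Rightarrow> real) \<Rightarrow> bool" where
  "Linf S f \<longleftrightarrow> f \<in> borel_measurable (lebesgue_on {0<..<S}) \<and>
     (\<exists>C. AE s in lebesgue_on {0<..<S}. \<bar>f s\<bar> \<le> C)"

definition test_function :: "real \<Rightarrow> (real \<Rightarrow> real) \<Rightarrow> bool" where
  "test_function S \<phi> \<longleftrightarrow>
     (\<forall>n. ((deriv ^^ n) \<phi>) differentiable_on UNIV) \<and>
     compact (closure {x. \<phi> x \<noteq> 0}) \<and> closure {x. \<phi> x \<noteq> 0} \<subseteq> {0<..<S}"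

text \<open>
  \<open>W1inf S f f'\<close>: \<open>f\<close> is the continuous representative on \<open>[0,S]\<close> of a member of \<open>W\<^sup>1\<^sup>,\<^sup>\<infinity>(0,S)\<close> and
  \<open>f'\<close> is a representative of its weak derivative (which is determined up to null sets).
\<close>

definition W1inf :: "real \<Rightarrow> (real \<Rightarrow> real) \<Rightarrow> (real \<Rightarrow> real) \<Rightarrow> bool" where
  "W1inf S f f' \<longleftrightarrow> continuous_on {0..S} f \<and> Linf S f \<and> Linf S f' \<and>
     (\<forall>\<phi>. test_function S \<phi> \<longrightarrow>
        (LINT s:{0<..<S}|lebesgue. f s * deriv \<phi> s) = - (LINT s:{0<..<S}|lebesgue. f' s * \<phi> s))"

subsection \<open>The Kurzweil--Stieltjes integral\<close>

definition has_ks_integral ::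
    "(real \<Rightarrow> real) \<Rightarrow> (real \<Rightarrow> real) \<Rightarrow> real \<Rightarrow> real \<Rightarrow> real \<Rightarrow> bool" where
  "has_ks_integral f g a b y \<longleftrightarrow>
     (\<forall>e>0. \<exists>\<gamma>. gauge \<gamma> \<and>
        (\<forall>p. p tagged_division_of cbox a b \<and> \<gamma> fine p \<longrightarrow>
           \<bar>(\<Sum>(x, K)\<in>p. f x * (g (Sup K) - g (Inf K))) - y\<bar> < e))"

definition ks_integral :: "(real \<Rightarrow> real) \<Rightarrow> (real \<Rightarrow> real) \<Rightarrow> real \<Rightarrow> real \<Rightarrow> real" where
  "ks_integral f g a b = (THE y. has_ks_integral f g a b y)"

lemma has_ks_integral_unique:
  assumes "has_ks_integral f g a b y1" "has_ks_integral f g a b y2"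
  shows "y1 = y2"
proof (rule ccontr)
  assume "y1 \<noteq> y2"
  define e where "e = \<bar>y1 - y2\<bar> / 2"
  have e: "e > 0" using \<open>y1 \<noteq> y2\<close> by (simp add: e_def)
  let ?S = "\<lambda>p. \<Sum>(x, K)\<in>p. f x * (g (Sup K) - g (Inf K))"
  obtain \<gamma>1 where 1: "gauge \<gamma>1"
      "\<And>p. p tagged_division_of cbox a b \<Longrightarrow> \<gamma>1 fine p \<Longrightarrow> \<bar>?S p - y1\<bar> < e"
    using assms(1)[unfolded has_ks_integral_def, rule_format, OF e] by auto
  obtain \<gamma>2 where 2: "gauge \<gamma>2"
      "\<And>p. p tagged_division_of cbox a b \<Longrightarrow> \<gamma>2 fine p \<Longrightarrow> \<bar>?S p - y2\<bar> < e"
    using assms(2)[unfolded has_ks_integral_def, rule_format, OF e] by auto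
  obtain p where p: "p tagged_division_of cbox a b" "(\<lambda>x. \<gamma>1 x \<inter> \<gamma>2 x) fine p"
    by (rule fine_division_exists[OF gauge_Int[OF 1(1) 2(1)], of a b])
  have "\<bar>?S p - y1\<bar> < e" "\<bar>?S p - y2\<bar> < e"
    using p(2) 1(2)[OF p(1)] 2(2)[OF p(1)] by (simp_all only: fine_Int)
  moreover have "\<bar>y1 - y2\<bar> \<le> \<bar>?S p - y1\<bar> + \<bar>?S p - y2\<bar>" by linarith
  ultimately show False by (simp add: e_def)
qed

lemma ks_integral_eqI: "has_ks_integral f g a b y \<Longrightarrow> ks_integral f g a b = y"
  unfolding ks_integral_def by (rule the_equality) (auto dest: has_ks_integral_unique)

subsection \<open>Rate-independent systems in one dimension\<close>

definition subdifferential :: "(real \<Rightarrow> real) \<Rightarrow> real \<Rightarrow> real set" where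
  "subdifferential R v = {\<xi>. \<forall>w. R w \<ge> R v + \<xi> * (w - v)}"

definition energy :: "(real \<Rightarrow> real) \<Rightarrow> (real \<Rightarrow> real) \<Rightarrow> real \<Rightarrow> real \<Rightarrow> real" where
  "energy E l t z = E z - l t * z"

definition residual ::
    "(real \<Rightarrow> real) \<Rightarrow> (real \<Rightarrow> real) \<Rightarrow> (real \<Rightarrow> real) \<Rightarrow> real \<Rightarrow> real \<Rightarrow> real" where
  "residual E R l t z = infdist (- deriv (energy E l t) z) (subdifferential R 0)"

definition relaxed_solution ::
    "(real \<Rightarrow> real) \<Rightarrow> (real \<Rightarrow> real) \<Rightarrow> real \<Rightarrow> real \<Rightarrow> (real \<Rightarrow> real) \<Rightarrow>
     real \<Rightarrow> (real \<Rightarrow> real) \<Rightarrow> (real \<Rightarrow> real) \<Rightarrow> (real \<Rightarrow> real) \<Rightarrow> bool" where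
  "relaxed_solution E R T z0 l S that zhat lhat \<longleftrightarrow>
     S > 0 \<and> BV 0 S lhat \<and>
     (\<exists>that' zhat'. W1inf S that that' \<and> W1inf S zhat zhat' \<and>
        that 0 = 0 \<and> that S = T \<and> zhat 0 = z0 \<and>
        (AE s in lebesgue_on {0<..<S}.
           that' s \<ge> 0 \<and>
           that' s * residual E R lhat s (zhat s) = 0 \<and>
           that' s + R (zhat' s) + \<bar>zhat' s\<bar> * residual E R lhat s (zhat s) = 1) \<and>
        (\<forall>s1\<in>{0..S}. \<forall>s2\<in>{0..S}.
           E (zhat s2) + interval_lebesgue_integral lebesgue (ereal s1) (ereal s2)
               (\<lambda>r. R (zhat' r) + \<bar>zhat' r\<bar> * residual E R lhat r (zhat r))
           = E (zhat s1) + interval_lebesgue_integral lebesgue (ereal s1) (ereal s2)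
               (\<lambda>r. lhat r * zhat' r)) \<and>
        (AE s in lebesgue.
           s \<in> {s\<in>{0<..<S}. \<forall>s1\<in>{0..S}. \<forall>s2\<in>{0..S}. s1 < s \<and> s < s2 \<longrightarrow> that s1 < that s2}
           \<longrightarrow> lhat s = l (that s)))"

definition projections ::
    "real \<Rightarrow> real \<Rightarrow> (real \<Rightarrow> real) \<Rightarrow> (real \<Rightarrow> real) \<Rightarrow> (real \<Rightarrow> real) set" where
  "projections T S that zhat = {z. \<forall>t\<in>{0..T}. \<exists>s\<in>{0..S}. (t, z t) = (that s, zhat s)}"

definition local_solution ::
    "(real \<Rightarrow> real) \<Rightarrow> (real \<Rightarrow> real) \<Rightarrow> real \<Rightarrow> (real \<Rightarrow> real) \<Rightarrow> (real \<Rightarrow> real) \<Rightarrow> bool" where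
  "local_solution E R T l z \<longleftrightarrow>
     BV 0 T z \<and>
     (AE t in lebesgue_on {0..T}.
        0 \<in> (\<lambda>\<xi>. \<xi> + deriv (energy E l t) (z t)) ` subdifferential R 0) \<and>
     (\<forall>t1 t2. 0 \<le> t1 \<and> t1 \<le> t2 \<and> t2 \<le> T \<longrightarrow>
        ereal (energy E l t2 (z t2)) + Diss R z t1 t2
          \<le> ereal (energy E l t1 (z t1) - ks_integral z l t1 t2))"

end

theory Submission
  imports Defs
begin

text \<open>
  Writing \<open>r(s) = -D\<^sub>z I(s, z(s)) = 1 - z(s) + \<ell>(s)\<close> for the driving force along the parametrized
  path, the value of \<open>r\<close> is 1 while \<open>z\<close> rests at 0 and also during the jump, where the artificial
  load \<open>\<ell> = z\<close> exactly compensates the decrease of \<open>1 - z\<close>; afterwards it is 1/2.  Hence the force never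
  leaves \<open>[-1,1]\<close>, the subdifferential of the modulus at 0 (\<open>subdifferential_abs_0\<close>), and all the
  distances in the definition of a relaxed solution vanish (\<open>residual_eq_0\<close>).  What is left of the
  normalization is \<open>t' + \<bar>z'\<bar> = 1\<close>, true because \<open>t(s) = s - z(s)\<close> with \<open>z\<close> nondecreasing and
  1-Lipschitz.  The energy identity reduces to the chain rule: \<open>\<integral> \<bar>z'\<bar>\<close> is the increment of \<open>z\<close>, and
  since \<open>\<ell> = z\<close> during the jump and \<open>z' = 0\<close> otherwise, the work \<open>\<integral> \<ell> z'\<close> is the increment of \<open>z\<^sup>2 / 2 = E(z) + z\<close>.  The load
  may differ from the given one on the jump because \<open>t\<close> is constant there.

  A projection, however, forgets the artificial load.  It starts at 0 and ends at 1/2, so it dissipates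
  at least 1/2, while it releases only the energy \<open>E(0) - E(1/2) = 3/8\<close> and the zero load does no
  work (\<open>ks_integral_constant_integrator\<close>).  The energy inequality on the whole interval is therefore
  violated by at least 1/8: the amount \<open>z\<^sup>2 / 2\<close> of work that the artificial load did during the jump.

  All functions in the example are piecewise affine.  Weak derivatives and energy integrals are
  therefore both obtained from one form of the fundamental theorem of calculus, for continuous functions
  with a bounded derivative off a finite set (\<open>bounded_derivative_integral\<close>).
\<close>

section \<open>The fundamental theorem of calculus with finitely many corners\<close>

text \<open>
  For the Henstock-Kurzweil integral the fundamental theorem needs no integrability assumption on \<open>g\<close>,
  and integrability in that sense yields measurability; boundedness then makes \<open>g\<close> Lebesgue integrable.
\<close>

lemma bounded_derivative_integral:
  fixes F g :: "real \<Rightarrow> real"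
  assumes ab: "a \<le> b" and K: "finite K" and cont: "continuous_on {a..b} F"
    and der: "\<And>x. x \<in> {a<..<b} - K \<Longrightarrow> (F has_real_derivative g x) (at x)"
    and bd: "\<And>x. x \<in> {a<..<b} \<Longrightarrow> \<bar>g x\<bar> \<le> C"
  shows "set_integrable lebesgue {a<..<b} g"
    and "(LINT x:{a<..<b}|lebesgue. g x) = F b - F a"
proof -
  have "(g has_integral (F b - F a)) {a..b}"
    by (rule fundamental_theorem_of_calculus_interior_strong[OF K ab _ cont])
      (use der in \<open>auto simp: has_real_derivative_iff_has_vector_derivative\<close>)
  then have hi: "(g has_integral (F b - F a)) {a<..<b}"
    by (simp add: has_integral_Icc_iff_Ioo)
  then have int: "g integrable_on {a<..<b}" by blast
  then have meas: "g \<in> borel_measurable (lebesgue_on {a<..<b})"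
    by (rule integrable_imp_measurable)
  have "(\<lambda>_. C) integrable_on {a<..<b}"
    unfolding integrable_on_Icc_iff_Ioo [symmetric] by (rule integrable_const_ivl)
  then show abs: "set_integrable lebesgue {a<..<b} g"
    using meas bd
    by (intro measurable_bounded_by_integrable_imp_absolutely_integrable[where g = "\<lambda>_. C"]) auto
  show "(LINT x:{a<..<b}|lebesgue. g x) = F b - F a"
    using set_lebesgue_integral_eq_integral(2)[OF abs] integral_unique[OF hi] by simp
qed

lemma interval_integral_bounded_derivative:
  fixes F g :: "real \<Rightarrow> real"
  assumes K: "finite K" and cont: "continuous_on {a..b} F"
    and der: "\<And>x. x \<in> {a<..<b} - K \<Longrightarrow> (F has_real_derivative g x) (at x)"
    and bd: "\<And>x. x \<in> {a<..<b} \<Longrightarrow> \<bar>g x\<bar> \<le> C"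
    and st: "s \<in> {a..b}" "t \<in> {a..b}"
  shows "interval_lebesgue_integral lebesgue (ereal s) (ereal t) g = F t - F s"
proof -
  have "(LINT x:{u<..<v}|lebesgue. g x) = F v - F u"
    if "u \<le> v" "u \<in> {a..b}" "v \<in> {a..b}" for u v
    by (rule bounded_derivative_integral(2)[OF that(1) K, where C = C])
      (use that der bd in \<open>auto intro: continuous_on_subset[OF cont]\<close>)
  then show ?thesis
    using st by (auto simp: interval_lebesgue_integral_def)
qed

section \<open>Membership in the function spaces\<close>

text \<open>
  Integration by parts against a test function \<open>\<phi>\<close>: the product \<open>f \<phi>\<close> is again continuous with a bounded
  derivative off \<open>K\<close>, and it vanishes at both end points because the support of \<open>\<phi>\<close> is a subset of the
  open interval.
\<close>

lemma W1inf_bounded_derivative: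
  fixes f f' :: "real \<Rightarrow> real"
  assumes S: "0 \<le> S" and K: "finite K" and cont: "continuous_on {0..S} f"
    and der: "\<And>x. x \<in> {0<..<S} - K \<Longrightarrow> (f has_real_derivative f' x) (at x)"
    and bd: "\<And>x. x \<in> {0<..<S} \<Longrightarrow> \<bar>f' x\<bar> \<le> C"
  shows "W1inf S f f'"
proof -
  have contI: "continuous_on {0<..<S} f"
    using cont by (rule continuous_on_subset) auto
  have meas: "f \<in> borel_measurable (lebesgue_on {0<..<S})"
    by (rule continuous_imp_measurable_on_sets_lebesgue[OF contI]) auto
  obtain B where B: "\<And>x. x \<in> {0..S} \<Longrightarrow> \<bar>f x\<bar> \<le> B"
    using continuous_on_compact_bound[OF compact_Icc cont] by auto
  have "Linf S f"
    unfolding Linf_def using meas B by (auto intro!: exI[of _ B] AE_I2)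
  have "f' integrable_on {0<..<S}"
    using set_lebesgue_integral_eq_integral(1)[OF bounded_derivative_integral(1)[OF S K cont der bd]]
    by simp
  then have "Linf S f'"
    unfolding Linf_def using bd by (auto intro!: exI[of _ C] AE_I2 integrable_imp_measurable)
  have "(LINT s:{0<..<S}|lebesgue. f s * deriv \<phi> s) = - (LINT s:{0<..<S}|lebesgue. f' s * \<phi> s)"
    if \<phi>: "test_function S \<phi>" for \<phi>
  proof -
    have d0: "\<phi> differentiable_on UNIV" and d1: "deriv \<phi> differentiable_on UNIV"
      using \<phi> unfolding test_function_def by (metis funpow_0, metis funpow_0 funpow.simps(2) o_apply)
    have der\<phi>: "(\<phi> has_real_derivative deriv \<phi> x) (at x)" for x
      using d0 unfolding differentiable_on_def
      by (metis DERIV_imp_deriv UNIV_I real_differentiable_def)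
    have c0: "continuous_on A \<phi>" and c1: "continuous_on A (deriv \<phi>)" for A
      using d0 d1 by (auto intro: continuous_on_subset[OF differentiable_imp_continuous_on])
    have "0 \<notin> closure {x. \<phi> x \<noteq> 0}" "S \<notin> closure {x. \<phi> x \<noteq> 0}"
      using \<phi> unfolding test_function_def by auto
    then have bdry: "\<phi> 0 = 0" "\<phi> S = 0"
      using closure_subset[of "{x. \<phi> x \<noteq> 0}"] by auto
    obtain P where P: "\<And>x. x \<in> {0..S} \<Longrightarrow> \<bar>\<phi> x\<bar> \<le> P"
      using continuous_on_compact_bound[OF compact_Icc c0[of "{0..S}"]] by auto
    have cfd: "continuous_on {0..S} (\<lambda>x. f x * deriv \<phi> x)"
      by (intro continuous_intros cont c1)
    obtain D where D: "\<And>x. x \<in> {0..S} \<Longrightarrow> \<bar>f x * deriv \<phi> x\<bar> \<le> D"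
      using continuous_on_compact_bound[OF compact_Icc cfd] by (metis real_norm_def)
    let ?g = "\<lambda>x. f' x * \<phi> x + f x * deriv \<phi> x"
    have cp: "continuous_on {0..S} (\<lambda>x. f x * \<phi> x)"
      by (intro continuous_intros cont c0)
    have dp: "((\<lambda>x. f x * \<phi> x) has_real_derivative ?g x) (at x)" if "x \<in> {0<..<S} - K" for x
      using DERIV_mult[OF der[OF that] der\<phi>] by (simp add: algebra_simps)
    have bp: "\<bar>?g x\<bar> \<le> C * P + D" if "x \<in> {0<..<S}" for x
    proof -
      have "\<bar>f' x * \<phi> x\<bar> \<le> C * P"
        unfolding abs_mult using bd[OF that] P[of x] that by (intro mult_mono) auto
      then show ?thesis using D[of x] that by auto
    qed
    have ig: "set_integrable lebesgue {0<..<S} ?g" and g0: "(LINT x:{0<..<S}|lebesgue. ?g x) = 0"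
      using bounded_derivative_integral[OF S K cp dp bp] bdry by auto
    have "(\<lambda>x. f x * deriv \<phi> x) absolutely_integrable_on {0..S}"
      using cfd by (rule absolutely_integrable_continuous_real)
    then have i2: "set_integrable lebesgue {0<..<S} (\<lambda>x. f x * deriv \<phi> x)"
      by (rule set_integrable_subset) auto
    \<comment> \<open>Subtracting the continuous summand avoids a separate measurability argument for \<open>f' \<phi>\<close>.\<close>
    have i1: "set_integrable lebesgue {0<..<S} (\<lambda>x. f' x * \<phi> x)"
      using set_integral_diff(1)[OF ig i2] by simp
    show ?thesis
      using g0 set_integral_add(2)[OF i1 i2] by simp
  qed
  with cont \<open>Linf S f\<close> \<open>Linf S f'\<close> show ?thesis
    unfolding W1inf_def by blast
qed

text \<open>
  The easy half of the Jordan decomposition: the variation of \<open>u - v\<close> along any partition is at most that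
  of the monotone function \<open>u + v\<close>, which telescopes.
\<close>

lemma BV_diff_mono:
  fixes f u v :: "real \<Rightarrow> real"
  assumes u: "mono_on {a..b} u" and v: "mono_on {a..b} v"
    and f: "\<And>x. x \<in> {a..b} \<Longrightarrow> f x = u x - v x"
  shows "BV a b f"
proof -
  have le: "(\<Sum>i=1..n. \<bar>f (\<xi> i) - f (\<xi> (i - 1))\<bar>) \<le> (u b - u a) + (v b - v a)"
    if \<xi>: "\<xi> 0 = a" "\<xi> n = b" "\<forall>i\<in>{1..n}. \<xi> (i - 1) < \<xi> i" for n :: nat and \<xi> :: "nat \<Rightarrow> real"
  proof -
    have step: "\<xi> i \<le> \<xi> (Suc i)" if "i < n" for i
      using \<xi>(3)[rule_format, of "Suc i"] that by auto
    have low: "i \<le> n \<Longrightarrow> a \<le> \<xi> i" for i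
      by (induction i) (use step \<xi>(1) order_trans in \<open>auto simp: Suc_le_eq\<close>)
    have up: "\<xi> i \<le> b" if "i \<le> n" for i
      using that by (induction rule: inc_induct) (use step \<xi>(2) order_trans in \<open>auto\<close>)
    have "(\<Sum>i=1..n. \<bar>f (\<xi> i) - f (\<xi> (i - 1))\<bar>)
        \<le> (\<Sum>i=1..n. (u (\<xi> i) + v (\<xi> i)) - (u (\<xi> (i - 1)) + v (\<xi> (i - 1))))"
    proof (rule sum_mono)
      fix i assume i: "i \<in> {1..n}"
      then have r: "\<xi> (i - 1) \<in> {a..b}" "\<xi> i \<in> {a..b}" "\<xi> (i - 1) \<le> \<xi> i"
        using low[of i] low[of "i - 1"] up[of i] up[of "i - 1"] \<xi>(3) by force+
      then show "\<bar>f (\<xi> i) - f (\<xi> (i - 1))\<bar>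
          \<le> (u (\<xi> i) + v (\<xi> i)) - (u (\<xi> (i - 1)) + v (\<xi> (i - 1)))"
        using mono_onD[OF u r] mono_onD[OF v r] f by auto
    qed
    also have "\<dots> = (u b - u a) + (v b - v a)"
      using sum_telescope''[of 0 n "\<lambda>i. u (\<xi> i) + v (\<xi> i)"] \<xi> by simp
    finally show ?thesis .
  qed
  have "Diss abs f a b \<le> ereal ((u b - u a) + (v b - v a))"
    unfolding Diss_def by (rule Sup_least) (use le in auto)
  then show ?thesis
    unfolding BV_def by (rule le_less_trans) simp
qed

section \<open>Dissipation, Stieltjes integral and residual\<close>

lemma Diss_ge:
  assumes "a < b"
  shows "ereal (R (f b - f a)) \<le> Diss R f a b"
proof -
  define \<xi> :: "nat \<Rightarrow> real" where "\<xi> = (\<lambda>i. if i = 0 then a else b)"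
  have "(\<Sum>i=1..1. R (f (\<xi> i) - f (\<xi> (i - 1)))) = R (f b - f a)"
    by (simp add: \<xi>_def)
  moreover have "\<xi> 0 = a \<and> \<xi> 1 = b \<and> (\<forall>i\<in>{1..1}. \<xi> (i - 1) < \<xi> i)"
    using assms by (simp add: \<xi>_def)
  ultimately show ?thesis
    unfolding Diss_def by (intro Sup_upper CollectI exI[of _ 1] exI[of _ \<xi>]) simp
qed

lemma ks_integral_constant_integrator:
  assumes "\<And>x. x \<in> {a..b} \<Longrightarrow> g x = c"
  shows "ks_integral f g a b = 0"
proof (rule ks_integral_eqI)
  have sum0: "(\<Sum>(x, K)\<in>p. f x * (g (Sup K) - g (Inf K))) = 0"
    if p: "p tagged_division_of cbox a b" for p
  proof (rule sum.neutral, rule ballI)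
    fix q assume "q \<in> p"
    obtain x K where q: "q = (x, K)" by (cases q)
    with \<open>q \<in> p\<close> have "(x, K) \<in> p" by simp
    note K = tagged_division_ofD(2-4)[OF p this]
    obtain u v where uv: "K = cbox u v" using K(3) by auto
    have "u \<le> v" "a \<le> u" "v \<le> b" using K(1,2) uv by auto
    then have "g (Sup K) = c" "g (Inf K) = c"
      using assms uv by simp_all
    then show "(case q of (x, K) \<Rightarrow> f x * (g (Sup K) - g (Inf K))) = 0"
      by (simp add: q)
  qed
  show "has_ks_integral f g a b 0"
    unfolding has_ks_integral_def
  proof (intro allI impI exI conjI)
    fix e :: real and p
    assume "0 < e" "p tagged_division_of cbox a b \<and> (\<lambda>x. ball x 1) fine p"
    then show "\<bar>(\<Sum>(x, K)\<in>p. f x * (g (Sup K) - g (Inf K))) - 0\<bar> < e"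
      using sum0[of p] by simp
  qed (rule gauge_trivial)
qed

lemma subdifferential_abs_0: "subdifferential abs 0 = {-1..1}"
proof (intro set_eqI iffI)
  fix \<xi> :: real assume "\<xi> \<in> subdifferential abs 0"
  then have "\<xi> * w \<le> \<bar>w\<bar>" for w
    by (simp add: subdifferential_def)
  from this[of 1] this[of "-1"] show "\<xi> \<in> {-1..1}" by simp
next
  fix \<xi> :: real assume "\<xi> \<in> {-1..1}"
  then have "\<bar>\<xi>\<bar> * \<bar>w\<bar> \<le> 1 * \<bar>w\<bar>" for w
    by (intro mult_right_mono) auto
  then have "\<xi> * w \<le> \<bar>w\<bar>" for w
    by (metis abs_le_D1 abs_mult mult_1)
  then show "\<xi> \<in> subdifferential abs 0"
    by (simp add: subdifferential_def)
qed

text \<open>The assumption says that the driving force \<open>-D\<^sub>z I(s, z)\<close> is admissible.\<close>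

lemma residual_eq_0:
  assumes "l s - z + 1 \<in> {-1..1}"
  shows "residual (\<lambda>z. 1 / 2 * z ^ 2 - z) abs l s z = 0"
proof -
  have "(energy (\<lambda>z. 1 / 2 * z ^ 2 - z) l s has_real_derivative z - 1 - l s) (at z)"
    unfolding energy_def by (auto intro!: derivative_eq_intros)
  then have "deriv (energy (\<lambda>z. 1 / 2 * z ^ 2 - z) l s) z = z - 1 - l s"
    by (rule DERIV_imp_deriv)
  then show ?thesis
    unfolding residual_def subdifferential_abs_0 using assms
    by (intro infdist_zero) (simp add: algebra_simps)
qed

section \<open>The example\<close>

theorem mainTheorem3:
  fixes T S z0 :: real and R E l zhat that lhat :: "real \<Rightarrow> real"
  assumes "T = 2" and "z0 = 0"
    and "R = (\<lambda>v. \<bar>v\<bar>)"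
    and "E = (\<lambda>z. 1 / 2 * z ^ 2 - z)"
    and "\<forall>t\<in>{0..2}. l t = 0"
    and "S = 5 / 2"
    and "\<forall>s\<in>{0..1}. zhat s = 0"
    and "\<forall>s\<in>{1<..<3/2}. zhat s = s - 1"
    and "\<forall>s\<in>{3/2..5/2}. zhat s = 1 / 2"
    and "\<forall>s\<in>{0..1}. that s = s"
    and "\<forall>s\<in>{1<..<3/2}. that s = 1"
    and "\<forall>s\<in>{3/2..5/2}. that s = s - 1 / 2"
    and "\<forall>s\<in>{0..1}. lhat s = 0"
    and "\<forall>s\<in>{1<..<3/2}. lhat s = s - 1"
    and "\<forall>s\<in>{3/2..5/2}. lhat s = 0"
  shows "relaxed_solution E R T z0 l S that zhat lhat \<and>
         (\<forall>z\<in>projections T S that zhat. \<not> local_solution E R T l z)"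
proof
  \<comment> \<open>Pointwise representatives of the derivatives.  The values at the two corners are free; defining
    \<open>t'\<close> from \<open>z'\<close> makes \<open>t' + \<bar>z'\<bar> = 1\<close> hold at the corners, too.\<close>
  define z' :: "real \<Rightarrow> real" where "z' = indicator {1..3/2}"
  define t' :: "real \<Rightarrow> real" where "t' = (\<lambda>s. 1 - z' s)"
  note R = assms(3) and E = assms(4) and l = assms(5) and S = assms(6)
  have zhat_eq: "zhat s = max 0 (min (s - 1) (1/2))" if "s \<in> {0..5/2}" for s
    using that assms(7-9) by (cases "s \<le> 1"; cases "s < 3/2") auto
  have that_eq: "that s = s - zhat s" if "s \<in> {0..5/2}" for s
    using that assms(7-12) by (cases "s \<le> 1"; cases "s < 3/2") auto
  \<comment> \<open>A difference of monotone functions, hence of bounded variation.\<close>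
  have lhat_eq: "lhat s = zhat s - (if s < 3/2 then 0 else 1/2)" if "s \<in> {0..5/2}" for s
    using that assms(7-9,13-15) by (cases "s \<le> 1"; cases "s < 3/2") auto
  have cz: "continuous_on {0..5/2} zhat"
    by (rule continuous_on_eq[of _ "\<lambda>s. max 0 (min (s - 1) (1/2))"])
      (auto intro!: continuous_intros simp: zhat_eq)
  have ct: "continuous_on {0..5/2} that"
    by (rule continuous_on_eq[of _ "\<lambda>s. s - zhat s"])
      (auto intro!: continuous_intros cz simp: that_eq)
  have dz: "(zhat has_real_derivative z' s) (at s)" if s: "s \<in> {0<..<5/2} - {1, 3/2}" for s
  proof -
    consider "s \<in> {0<..<1}" | "s \<in> {1<..<3/2}" | "s \<in> {3/2<..<5/2}"
      using s by fastforce
    then show ?thesis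
    proof cases
      case 1
      have "((\<lambda>_. 0) has_real_derivative z' s) (at s)" using 1 by (simp add: z'_def)
      then show ?thesis
        by (rule has_field_derivative_transform_within_open[OF _ _ 1]) (use assms(7) in auto)
    next
      case 2
      have "((\<lambda>s. s - 1) has_real_derivative z' s) (at s)"
        using 2 by (auto simp: z'_def intro!: derivative_eq_intros)
      then show ?thesis
        by (rule has_field_derivative_transform_within_open[OF _ _ 2]) (use assms(8) in auto)
    next
      case 3
      have "((\<lambda>_. 1/2) has_real_derivative z' s) (at s)" using 3 by (simp add: z'_def)
      then show ?thesis
        by (rule has_field_derivative_transform_within_open[OF _ _ 3]) (use assms(9) in auto)
    qed
  qed
  have dt: "(that has_real_derivative t' s) (at s)" if s: "s \<in> {0<..<5/2} - {1, 3/2}" for s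
  proof -
    have "((\<lambda>s. s - zhat s) has_real_derivative t' s) (at s)"
      unfolding t'_def by (intro derivative_intros dz s)
    then show ?thesis
      by (rule has_field_derivative_transform_within_open[where S = "{0<..<5/2}"])
        (use s that_eq in auto)
  qed
  have z'01: "z' s \<in> {0, 1}" for s by (simp add: z'_def indicator_def)
  have res: "residual E R lhat s (zhat s) = 0" if s: "s \<in> {0..5/2}" for s
    unfolding E R using lhat_eq[OF s] by (intro residual_eq_0) (auto split: if_splits)
  show "relaxed_solution E R T z0 l S that zhat lhat"
    unfolding relaxed_solution_def
  proof (intro conjI, goal_cases)
    case 1
    show ?case by (simp add: S)
  next
    case 2
    show ?case
      unfolding S
      by (rule BV_diff_mono[of _ _ zhat "\<lambda>s. if s < 3/2 then 0 else 1/2"])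
        (auto simp: mono_on_def zhat_eq lhat_eq)
  next
    case 3
    show ?case
    proof (rule exI[of _ t'], rule exI[of _ z'], intro conjI)
      show "W1inf S that t'"
        unfolding S
        by (rule W1inf_bounded_derivative[of _ "{1, 3/2}" _ _ 1])
          (use ct dt z'01 in \<open>auto simp: t'_def z'_def indicator_def\<close>)
      show "W1inf S zhat z'"
        unfolding S
        by (rule W1inf_bounded_derivative[of _ "{1, 3/2}" _ _ 1])
          (use cz dz z'01 in \<open>auto simp: z'_def indicator_def\<close>)
      show "that 0 = 0" "that S = T" "zhat 0 = z0"
        using assms by auto
      show "AE s in lebesgue_on {0<..<S}.
          t' s \<ge> 0 \<and> t' s * residual E R lhat s (zhat s) = 0 \<and>
          t' s + R (z' s) + \<bar>z' s\<bar> * residual E R lhat s (zhat s) = 1"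
      proof (intro AE_I2)
        fix s assume "s \<in> space (lebesgue_on {0<..<S})"
        then show "t' s \<ge> 0 \<and> t' s * residual E R lhat s (zhat s) = 0 \<and>
            t' s + R (z' s) + \<bar>z' s\<bar> * residual E R lhat s (zhat s) = 1"
          using res[of s] z'01[of s] by (auto simp: S R t'_def)
      qed
      show "\<forall>s1\<in>{0..S}. \<forall>s2\<in>{0..S}.
          E (zhat s2) + interval_lebesgue_integral lebesgue (ereal s1) (ereal s2)
              (\<lambda>r. R (z' r) + \<bar>z' r\<bar> * residual E R lhat r (zhat r))
          = E (zhat s1) + interval_lebesgue_integral lebesgue (ereal s1) (ereal s2)
              (\<lambda>r. lhat r * z' r)"
      proof (intro ballI)
        fix s1 s2 assume s: "s1 \<in> {0..S}" "s2 \<in> {0..S}"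
        have "interval_lebesgue_integral lebesgue (ereal s1) (ereal s2)
            (\<lambda>r. R (z' r) + \<bar>z' r\<bar> * residual E R lhat r (zhat r)) = zhat s2 - zhat s1"
        proof (rule interval_integral_bounded_derivative[of "{1, 3/2}" 0 S _ _ 1])
          fix x assume x: "x \<in> {0<..<S} - {1, 3/2}"
          then have "R (z' x) + \<bar>z' x\<bar> * residual E R lhat x (zhat x) = z' x"
            using res[of x] z'01[of x] by (auto simp: R S)
          then show "(zhat has_real_derivative R (z' x) + \<bar>z' x\<bar> * residual E R lhat x (zhat x)) (at x)"
            using dz[of x] x S by simp
        next
          fix x assume "x \<in> {0<..<S}"
          then show "\<bar>R (z' x) + \<bar>z' x\<bar> * residual E R lhat x (zhat x)\<bar> \<le> 1"
            using res[of x] z'01[of x] by (auto simp: R S)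
        qed (use s cz[folded S] in auto)
        moreover have "interval_lebesgue_integral lebesgue (ereal s1) (ereal s2) (\<lambda>r. lhat r * z' r)
            = (zhat s2)\<^sup>2 / 2 - (zhat s1)\<^sup>2 / 2"
        proof (rule interval_integral_bounded_derivative[of "{1, 3/2}" 0 S _ _ 1])
          fix x assume x: "x \<in> {0<..<S} - {1, 3/2}"
          then have "lhat x * z' x = zhat x * z' x"
            using lhat_eq[of x] by (auto simp: S z'_def indicator_def)
          moreover have "((\<lambda>x. (zhat x)\<^sup>2 / 2) has_real_derivative zhat x * z' x) (at x)"
            using dz[of x] x S by (auto intro!: derivative_eq_intros)
          ultimately show "((\<lambda>x. (zhat x)\<^sup>2 / 2) has_real_derivative lhat x * z' x) (at x)"
            by (simp only:)
        next
          fix x assume "x \<in> {0<..<S}"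
          then show "\<bar>lhat x * z' x\<bar> \<le> 1"
            using lhat_eq[of x] zhat_eq[of x] z'01[of x] by (auto simp: S)
        next
          show "continuous_on {0..S} (\<lambda>x. (zhat x)\<^sup>2 / 2)"
            using cz[folded S] by (auto intro!: continuous_intros)
        qed (use s in auto)
        ultimately show "E (zhat s2) + interval_lebesgue_integral lebesgue (ereal s1) (ereal s2)
              (\<lambda>r. R (z' r) + \<bar>z' r\<bar> * residual E R lhat r (zhat r))
          = E (zhat s1) + interval_lebesgue_integral lebesgue (ereal s1) (ereal s2)
              (\<lambda>r. lhat r * z' r)"
          by (simp add: E)
      qed
      have "lhat s = l (that s)"
        if s: "s \<in> {0<..<S}"
          and M: "\<forall>s1\<in>{0..S}. \<forall>s2\<in>{0..S}. s1 < s \<and> s < s2 \<longrightarrow> that s1 < that s2" for s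
      proof -
        \<comment> \<open>Only the open jump interval is excluded: 1 and 3/2 belong to \<open>M\<close>, but the load vanishes there.\<close>
        have "s \<notin> {1<..<3/2}"
        proof
          assume a: "s \<in> {1<..<3/2}"
          have "that ((1 + s) / 2) < that ((s + 3/2) / 2)"
            by (rule M[rule_format]) (use a S in auto)
          then show False
            using a assms(11) by (auto simp: field_simps)
        qed
        then have "lhat s = 0"
          using s assms(13,15) by (auto simp: S not_less)
        moreover have "that s \<in> {0..2}"
          using s that_eq[of s] zhat_eq[of s] by (auto simp: S)
        ultimately show ?thesis using l by simp
      qed
      then show "AE s in lebesgue.
          s \<in> {s\<in>{0<..<S}. \<forall>s1\<in>{0..S}. \<forall>s2\<in>{0..S}. s1 < s \<and> s < s2 \<longrightarrow> that s1 < that s2}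
          \<longrightarrow> lhat s = l (that s)"
        by (intro AE_I2) auto
    qed
  qed
  show "\<forall>z\<in>projections T S that zhat. \<not> local_solution E R T l z"
  proof (intro ballI notI)
    fix z assume z: "z \<in> projections T S that zhat" and loc: "local_solution E R T l z"
    \<comment> \<open>The time \<open>t\<close> takes its end values 0 and 2 only at 0 and 5/2, so a projection is determined there.\<close>
    obtain s where s: "s \<in> {0..5/2}" "that s = 0" "z 0 = zhat s"
      using z unfolding projections_def assms(1) S by force
    have z0: "z 0 = 0"
      using s that_eq[of s] zhat_eq[of s] by (auto split: if_splits simp: max_def min_def)
    obtain r where r: "r \<in> {0..5/2}" "that r = 2" "z 2 = zhat r"
      using z unfolding projections_def assms(1) S by force
    have z2: "z 2 = 1/2"
      using r that_eq[of r] zhat_eq[of r] by (auto split: if_splits simp: max_def min_def)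
    have "ereal (energy E l 2 (z 2)) + ereal (R (z 2 - z 0)) \<le> ereal (energy E l 2 (z 2)) + Diss R z 0 2"
      by (intro add_left_mono Diss_ge) simp
    also have "\<dots> \<le> ereal (energy E l 0 (z 0) - ks_integral z l 0 2)"
      using loc unfolding local_solution_def assms(1) by simp
    also have "ks_integral z l 0 2 = 0"
      by (rule ks_integral_constant_integrator) (use l in auto)
    finally show False
      using l by (simp add: energy_def E R z0 z2 power2_eq_square)
  qed
qed

end
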